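(* Let $C$ be a product of an arbitrary family of compact metric spaces and let $f\colon C\to X$ be a retraction onto a space $X$. Then $X$ is Valdivia compact.
   Context: All spaces are Hausdorff and "map" means continuous map. A retraction is a map $f\colon C\to X$ having a right inverse, i.e. a map $g\colon X\to C$ with $fg=\mathrm{id}_X$. (An arbitrary product of metric compacta is called a (generalized) cube.) For a set $T$, $\Sigma(T)=\{x\in[0,1]^T: \{\alpha\in T: x(\alpha)\neq 0\}\text{ is countable}\}$. A compact space $X$ is Valdivia compact if for some set $T$ there is an embedding $h\colon X\to[0,1]^T$ with $h[X]=\operatorname{cl}(\Sigma(T)\cap h[X])$, the closure being taken in $[0,1]^T$. *)

theory Defs
  imports "HOL-Analysis.Analysis"
begin

definition unit_cube :: "'t set \<Rightarrow> ('t \<Rightarrow> real) topology"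
  where "unit_cube T = product_topology (\<lambda>_. top_of_set {0..1}) T"

definition Sigma_cube :: "'t set \<Rightarrow> ('t \<Rightarrow> real) set"
  where "Sigma_cube T = {x \<in> topspace (unit_cube T). countable {\<alpha> \<in> T. x \<alpha> \<noteq> 0}}"

definition valdivia_embedding :: "'b topology \<Rightarrow> 't set \<Rightarrow> ('b \<Rightarrow> 't \<Rightarrow> real) \<Rightarrow> bool"
  where "valdivia_embedding X T h \<longleftrightarrow>
    embedding_map X (unit_cube T) h \<and>
    h ` topspace X = unit_cube T closure_of (Sigma_cube T \<inter> h ` topspace X)"

text \<open>
  The mathematical definition quantifies over index sets \<open>T\<close> without restriction. HOL cannot
  quantify over types, so \<open>T\<close> is taken from the type of real functions on the points of \<open>X\<close>.
  This loses nothing: coordinates of \<open>h\<close> inducing the same function on \<open>X\<close> can be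
  identified; \<open>valdivia_compactI\<close> below shows that an index set of any type suffices.
\<close>

definition valdivia_compact :: "'b topology \<Rightarrow> bool"
  where "valdivia_compact X \<longleftrightarrow>
    compact_space X \<and> Hausdorff_space X \<and>
    (\<exists>(T :: ('b \<Rightarrow> real) set) h. valdivia_embedding X T h)"

lemma topspace_unit_cube: "topspace (unit_cube T) = (\<Pi>\<^sub>E _\<in>T. {0..1})"
  by (simp add: unit_cube_def)

lemma Hausdorff_unit_cube: "Hausdorff_space (unit_cube T)"
  by (simp add: unit_cube_def Hausdorff_space_product_topology Hausdorff_space_subtopology)

lemma valdivia_compactI:
  fixes T :: "'t set" and X :: "'b topology"
  assumes X: "compact_space X" "Hausdorff_space X" and h: "valdivia_embedding X T h"
  shows "valdivia_compact X"
proof -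
  define e where "e = (\<lambda>t x. h x t)"
  define T' where "T' = e ` T"
  define s where "s = inv_into T e"
  define r where "r = (\<lambda>y :: 't \<Rightarrow> real. restrict (\<lambda>g. y (s g)) T')"
  have sT: "s g \<in> T" and es: "e (s g) = g" if "g \<in> T'" for g
    using that by (auto simp: s_def T'_def inv_into_into f_inv_into_f)
  have emb: "embedding_map X (unit_cube T) h"
    and cl: "h ` topspace X = unit_cube T closure_of (Sigma_cube T \<inter> h ` topspace X)"
    using h by (auto simp: valdivia_embedding_def)
  have hc: "continuous_map X (unit_cube T) h"
    using emb embedding_map_def homeomorphic_imp_continuous_map continuous_map_in_subtopology by blast
  have hi: "inj_on h (topspace X)"
    using emb by (metis embedding_map_def homeomorphic_imp_injective_map)
  have rc: "continuous_map (unit_cube T) (unit_cube T') r"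
  proof -
    have "continuous_map (unit_cube T) (top_of_set {0..1}) (\<lambda>y. y (s g))" if "g \<in> T'" for g
      unfolding unit_cube_def by (rule continuous_map_product_projection[OF sT[OF that]])
    then show ?thesis
      unfolding r_def by (subst (2) unit_cube_def) (auto simp: continuous_map_componentwise)
  qed
  have rhc: "continuous_map X (unit_cube T') (r \<circ> h)"
    by (rule continuous_map_compose[OF hc rc])
  have rhi: "inj_on (r \<circ> h) (topspace X)"
  proof (rule inj_onI)
    fix x y assume x: "x \<in> topspace X" and y: "y \<in> topspace X" and eq: "(r \<circ> h) x = (r \<circ> h) y"
    have "h x t = h y t" if "t \<in> T" for t
    proof -
      have et: "e t \<in> T'" using that by (simp add: T'_def)
      have "h x (s (e t)) = h y (s (e t))"
        using fun_cong[OF eq, of "e t"] et by (simp add: r_def)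
      moreover have "h z (s (e t)) = h z t" for z
        using fun_cong[OF es[OF et], of z] by (simp add: e_def)
      ultimately show ?thesis by simp
    qed
    moreover have "h x \<in> topspace (unit_cube T)" "h y \<in> topspace (unit_cube T)"
      using hc x y by (auto simp: continuous_map_def)
    ultimately have "h x = h y"
      unfolding topspace_unit_cube by (blast intro: PiE_ext)
    then show "x = y" using hi x y by (auto dest: inj_onD)
  qed
  have clm: "closed_map X (unit_cube T') (r \<circ> h)"
    by (rule T1_Spaces.continuous_imp_closed_map[OF rhc X(1) Hausdorff_unit_cube])
  have emb': "embedding_map X (unit_cube T') (r \<circ> h)"
    by (rule injective_closed_imp_embedding_map[OF rhc clm rhi])
  have sub: "r ` (Sigma_cube T \<inter> h ` topspace X) \<subseteq> Sigma_cube T' \<inter> (r \<circ> h) ` topspace X"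
  proof -
    have "r y \<in> Sigma_cube T'" if y: "y \<in> Sigma_cube T" for y
    proof -
      have "inj_on s {g \<in> T'. r y g \<noteq> 0}"
        by (rule inj_on_inverseI[of _ e]) (auto simp: es)
      moreover have "s ` {g \<in> T'. r y g \<noteq> 0} \<subseteq> {t \<in> T. y t \<noteq> 0}"
        by (auto simp: sT r_def)
      moreover have "countable {t \<in> T. y t \<noteq> 0}" using y by (simp add: Sigma_cube_def)
      ultimately have "countable {g \<in> T'. r y g \<noteq> 0}"
        by (meson countable_image_inj_on countable_subset)
      moreover have "r y \<in> topspace (unit_cube T')"
        using rc y by (auto simp: continuous_map_def Sigma_cube_def)
      ultimately show ?thesis by (simp add: Sigma_cube_def)
    qed
    then show ?thesis by auto
  qed
  have "(r \<circ> h) ` topspace X = unit_cube T' closure_of (Sigma_cube T' \<inter> (r \<circ> h) ` topspace X)"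
  proof
    have "(r \<circ> h) ` topspace X = r ` (unit_cube T closure_of (Sigma_cube T \<inter> h ` topspace X))"
      using cl by (simp add: image_comp)
    also have "\<dots> \<subseteq> unit_cube T' closure_of (r ` (Sigma_cube T \<inter> h ` topspace X))"
      by (rule continuous_map_image_closure_subset[OF rc])
    also have "\<dots> \<subseteq> unit_cube T' closure_of (Sigma_cube T' \<inter> (r \<circ> h) ` topspace X)"
      by (rule closure_of_mono[OF sub])
    finally show "(r \<circ> h) ` topspace X \<subseteq> \<dots>" .
    show "unit_cube T' closure_of (Sigma_cube T' \<inter> (r \<circ> h) ` topspace X) \<subseteq> (r \<circ> h) ` topspace X"
      using clm by (intro closure_of_minimal) (auto simp: closed_map_def)
  qed
  then have "valdivia_embedding X T' (r \<circ> h)"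
    using emb' by (simp add: valdivia_embedding_def)
  then show ?thesis using X unfolding valdivia_compact_def by blast
qed

end

theory Submission
  imports Defs
begin

text \<open>
  Let \<open>r = g \<circ> f\<close> be the idempotent of the cube with range \<open>R\<close>, a copy of \<open>X\<close>. Each coordinate of \<open>r\<close>
  depends on countably many coordinates only, so the index set carries a well-founded linear preorder
  with countable classes for which \<open>r\<close> induces an idempotent on the coordinates in any initial segment
  \<open>J\<close>. Filling up with a base point \<open>z\<close> outside \<open>J\<close> and applying \<open>r\<close> gives a section of the restriction
  of \<open>R\<close> to \<open>J\<close>. The embedding of \<open>R\<close> measures how far each coordinate \<open>x a\<close> is from its value
  predicted by the section over the indices strictly below \<open>a\<close>. Points with countable support are dense
  by induction along the preorder: the restriction of \<open>R\<close> to \<open>J\<close> is open, and following the sections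
  extends a partial point without creating new nonzero coordinates.
\<close>

section \<open>Countable dependence of continuous maps on products of compacta\<close>

text \<open>The functions are the distances to the points of a countable dense set, truncated to the
  unit interval. Total boundedness supplies the dense set as a union of finite nets.\<close>

lemma compact_metrizable_separating_sequence:
  fixes X :: "'a topology"
  assumes "metrizable_space X" and "compact_space X"
  obtains \<psi> :: "nat \<Rightarrow> 'a \<Rightarrow> real"
  where "\<And>n. continuous_map X euclideanreal (\<psi> n)"
    and "\<And>n x. \<psi> n x \<in> {0..1}"
    and "\<And>x y. x \<in> topspace X \<Longrightarrow> y \<in> topspace X \<Longrightarrow> (\<And>n. \<psi> n x = \<psi> n y) \<Longrightarrow> x = y"
proof -
  obtain M d where "Metric_space M d" and X: "X = Metric_space.mtopology M d"
    using assms(1) by (auto simp: metrizable_space_def)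
  then interpret Metric_space M d by simp
  have "mtotally_bounded M"
    using assms(2) X compact_space_eq_mcomplete_mtotally_bounded by blast
  then have "\<forall>n. \<exists>F. finite F \<and> F \<subseteq> M \<and> M \<subseteq> (\<Union>x\<in>F. mball x (1 / real (Suc n)))"
    unfolding mtotally_bounded_def by simp
  then obtain F where F: "\<And>n. finite (F n)" "\<And>n. F n \<subseteq> M"
    "\<And>n. M \<subseteq> (\<Union>x\<in>F n. mball x (1 / real (Suc n)))"
    by metis
  define Q where "Q = (\<Union>n. F n)"
  have Q: "countable Q" "Q \<subseteq> M"
    using F(1,2) by (auto simp: Q_def intro: countable_finite)
  define q where "q = from_nat_into Q"
  \<comment> \<open>If \<open>Q\<close> is empty, \<open>from_nat_into\<close> returns an arbitrary
    point; the guard covers this case.\<close>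
  define \<psi> where "\<psi> n x = (if q n \<in> M then max 0 (min 1 (d (q n) x)) else 0)" for n x
  show thesis
  proof
    fix n
    have "continuous_map X euclideanreal (d (q n))" if "q n \<in> M"
    proof -
      have m: "mspace (metric (M, d)) = M" "mdist (metric (M, d)) = d"
        by auto
      have "X = mtopology_of (metric (M, d))"
        by (simp add: X mtopology_of_def)
      then have "continuous_map X euclidean (\<lambda>x. mdist (metric (M, d)) (q n) x)"
        using that by (intro continuous_map_mdist) (auto simp: X)
      then show ?thesis
        by simp
    qed
    then show "continuous_map X euclideanreal (\<psi> n)"
      unfolding \<psi>_def by (cases "q n \<in> M") (auto intro!: continuous_intros)
  next
    show "\<psi> n x \<in> {0..1}" for n x
      by (auto simp: \<psi>_def)
  next
    fix x y
    assume x: "x \<in> topspace X" and y: "y \<in> topspace X" and eq: "\<And>n. \<psi> n x = \<psi> n y"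
    have xy: "x \<in> M" "y \<in> M"
      using x y by (auto simp: X)
    show "x = y"
    proof (rule ccontr)
      assume "x \<noteq> y"
      then have "d x y > 0"
        using xy by simp
      \<comment> \<open>The minimum with 1 keeps \<open>d p x\<close> below the truncation level.
        Equal values at \<open>n\<close> then force \<open>d p y = d p x\<close>, and the triangle
        inequality gives \<open>d x y < d x y\<close>.\<close>
      then obtain m where m: "1 / real (Suc m) < min (d x y) 1 / 2"
        using reals_Archimedean[of "min (d x y) 1 / 2"] by (auto simp: inverse_eq_divide)
      obtain p where "p \<in> F m" "x \<in> mball p (1 / real (Suc m))"
        using F(3)[of m] xy by blast
      then have p: "p \<in> F m" "d p x < min (d x y) 1 / 2"
        using m unfolding in_mball by linarith+
      have "p \<in> Q"
        using p by (auto simp: Q_def)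
      then obtain n where n: "p = q n"
        unfolding q_def by (metis Q(1) from_nat_into_to_nat_on)
      have pM: "p \<in> M"
        using \<open>p \<in> Q\<close> Q by auto
      have "d x y \<le> d p x + d p y"
        using triangle[of x p y] xy pM by (simp add: commute)
      then show False
        using eq[of n] p(2) pM nonneg[of p x] nonneg[of p y]
        by (simp add: \<psi>_def n[symmetric] min_def max_def split: if_splits)
    qed
  qed
qed

text \<open>By compactness, finitely many basic boxes cover the product such that \<open>f\<close>
  stays within \<open>\<epsilon> / 2\<close> of its value at the centre of each. \<open>F\<close>
  collects the coordinates these boxes restrict, so points agreeing on \<open>F\<close> lie in a
  common box.\<close>

lemma continuous_real_depends_on_finite:
  fixes f :: "('i \<Rightarrow> 'a) \<Rightarrow> real"
  assumes compact: "compact_space (product_topology K I)"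
    and f: "continuous_map (product_topology K I) euclideanreal f" and "\<epsilon> > 0"
  obtains F where "finite F" and "F \<subseteq> I"
    and "\<And>x y. \<lbrakk>x \<in> topspace (product_topology K I); y \<in> topspace (product_topology K I);
      \<And>i. i \<in> F \<Longrightarrow> x i = y i\<rbrakk> \<Longrightarrow> \<bar>f x - f y\<bar> < \<epsilon>"
proof -
  let ?C = "product_topology K I"
  define nbhd where "nbhd x V \<longleftrightarrow> finite {i \<in> I. V i \<noteq> topspace (K i)} \<and> (\<forall>i\<in>I. openin (K i) (V i)) \<and>
    x \<in> Pi\<^sub>E I V \<and> (\<forall>y\<in>Pi\<^sub>E I V. \<bar>f y - f x\<bar> < \<epsilon> / 2)" for x V
  have "\<exists>V. nbhd x V" if x: "x \<in> topspace ?C" for x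
  proof -
    have "openin ?C {y \<in> topspace ?C. f y \<in> ball (f x) (\<epsilon> / 2)}"
      using f by (rule openin_continuous_map_preimage) (simp flip: open_openin)
    moreover have "x \<in> {y \<in> topspace ?C. f y \<in> ball (f x) (\<epsilon> / 2)}"
      using x \<open>\<epsilon> > 0\<close> by simp
    ultimately obtain V where V: "finite {i \<in> I. V i \<noteq> topspace (K i)}"
      "\<forall>i\<in>I. openin (K i) (V i)" "x \<in> Pi\<^sub>E I V"
      "Pi\<^sub>E I V \<subseteq> {y \<in> topspace ?C. f y \<in> ball (f x) (\<epsilon> / 2)}"
      unfolding openin_product_topology_alt by meson
    have "\<bar>f y - f x\<bar> < \<epsilon> / 2" if "y \<in> Pi\<^sub>E I V" for y
      using subsetD[OF V(4) that] by (simp add: dist_real_def abs_minus_commute)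
    then show ?thesis
      using V(1-3) unfolding nbhd_def by blast
  qed
  then obtain V where "\<And>x. x \<in> topspace ?C \<Longrightarrow> nbhd x (V x)"
    by metis
  then have V: "\<And>x. x \<in> topspace ?C \<Longrightarrow> finite {i \<in> I. V x i \<noteq> topspace (K i)}"
    "\<And>x i. x \<in> topspace ?C \<Longrightarrow> i \<in> I \<Longrightarrow> openin (K i) (V x i)"
    "\<And>x. x \<in> topspace ?C \<Longrightarrow> x \<in> Pi\<^sub>E I (V x)"
    "\<And>x y. x \<in> topspace ?C \<Longrightarrow> y \<in> Pi\<^sub>E I (V x) \<Longrightarrow> \<bar>f y - f x\<bar> < \<epsilon> / 2"
    unfolding nbhd_def by blast+
  have op: "openin ?C (Pi\<^sub>E I (V x))" if "x \<in> topspace ?C" for x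
    using V(1,2)[OF that] by (simp add: openin_PiE_gen)
  have "\<exists>\<F>. finite \<F> \<and> \<F> \<subseteq> (\<lambda>x. Pi\<^sub>E I (V x)) ` topspace ?C \<and> topspace ?C \<subseteq> \<Union>\<F>"
    using compact[unfolded compact_space_alt, rule_format, of "(\<lambda>x. Pi\<^sub>E I (V x)) ` topspace ?C"]
      op V(3) by blast
  then obtain S where S: "finite S" "S \<subseteq> topspace ?C"
    "topspace ?C \<subseteq> (\<Union>x\<in>S. Pi\<^sub>E I (V x))"
    by (metis finite_subset_image)
  define F where "F = (\<Union>x\<in>S. {i \<in> I. V x i \<noteq> topspace (K i)})"
  show thesis
  proof
    show "finite F"
      using S(1,2) V(1) by (auto simp: F_def)
    show "F \<subseteq> I"
      by (auto simp: F_def)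
  next
    fix x y
    assume x: "x \<in> topspace ?C" and y: "y \<in> topspace ?C" and eq: "\<And>i. i \<in> F \<Longrightarrow> x i = y i"
    obtain s where s: "s \<in> S" "x \<in> Pi\<^sub>E I (V s)"
      using S(3) x by blast
    have "y i \<in> V s i" if "i \<in> I" for i
    proof (cases "V s i = topspace (K i)")
      case True
      then show ?thesis
        using y that by auto
    next
      case False
      then have "i \<in> F"
        using that s by (auto simp: F_def)
      then show ?thesis
        using s(2) that eq[of i] by (metis PiE_mem)
    qed
    then have "y \<in> Pi\<^sub>E I (V s)"
      using y by (auto simp: PiE_iff)
    then have "\<bar>f x - f s\<bar> < \<epsilon> / 2" "\<bar>f y - f s\<bar> < \<epsilon> / 2"
      using V(4) s S(2) by blast+
    then show "\<bar>f x - f y\<bar> < \<epsilon>"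
      by linarith
  qed
qed

text \<open>Unite the finite sets obtained for the tolerances
  \<open>1 / real (Suc n)\<close>.\<close>

lemma continuous_real_depends_on_countable:
  fixes f :: "('i \<Rightarrow> 'a) \<Rightarrow> real"
  assumes "compact_space (product_topology K I)"
    and "continuous_map (product_topology K I) euclideanreal f"
  obtains N where "countable N" and "N \<subseteq> I"
    and "\<And>x y. \<lbrakk>x \<in> topspace (product_topology K I); y \<in> topspace (product_topology K I);
      \<And>i. i \<in> N \<Longrightarrow> x i = y i\<rbrakk> \<Longrightarrow> f x = f y"
proof -
  let ?C = "topspace (product_topology K I)"
  have "\<exists>F. finite F \<and> F \<subseteq> I \<and> (\<forall>x\<in>?C. \<forall>y\<in>?C. (\<forall>i\<in>F. x i = y i) \<longrightarrow> \<bar>f x - f y\<bar> < 1 / real (Suc n))"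
    for n
    using continuous_real_depends_on_finite[OF assms, of "1 / real (Suc n)"]
    by (metis divide_pos_pos of_nat_0_less_iff zero_less_Suc zero_less_one)
  then obtain F where F: "\<And>n. finite (F n)" "\<And>n. F n \<subseteq> I"
    "\<And>n x y. x \<in> ?C \<Longrightarrow> y \<in> ?C \<Longrightarrow> \<forall>i\<in>F n. x i = y i \<Longrightarrow> \<bar>f x - f y\<bar> < 1 / real (Suc n)"
    by metis
  show thesis
  proof
    show "countable (\<Union>n. F n)" "(\<Union>n. F n) \<subseteq> I"
      using F(1,2) by (auto intro: countable_finite)
  next
    fix x y
    assume xy: "x \<in> ?C" "y \<in> ?C" and eq: "\<And>i. i \<in> (\<Union>n. F n) \<Longrightarrow> x i = y i"
    show "f x = f y"
    proof (rule ccontr)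
      assume "f x \<noteq> f y"
      then obtain n where "1 / real (Suc n) < \<bar>f x - f y\<bar>"
        using reals_Archimedean[of "\<bar>f x - f y\<bar>"] by (auto simp: inverse_eq_divide)
      then show False
        using F(3)[OF xy, of n] eq by auto
    qed
  qed
qed

text \<open>A separating sequence on \<open>Y\<close> reduces this to countably many real-valued
  maps.\<close>

lemma continuous_metrizable_depends_on_countable:
  assumes C: "compact_space (product_topology K I)"
    and Y: "metrizable_space Y" "compact_space Y"
    and f: "continuous_map (product_topology K I) Y f"
  obtains N where "countable N" and "N \<subseteq> I"
    and "\<And>x y. \<lbrakk>x \<in> topspace (product_topology K I); y \<in> topspace (product_topology K I);
      \<And>i. i \<in> N \<Longrightarrow> x i = y i\<rbrakk> \<Longrightarrow> f x = f y"
proof -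
  let ?C = "topspace (product_topology K I)"
  obtain \<psi> :: "nat \<Rightarrow> _ \<Rightarrow> real"
    where \<psi>: "\<And>n. continuous_map Y euclideanreal (\<psi> n)"
      "\<And>x y. x \<in> topspace Y \<Longrightarrow> y \<in> topspace Y \<Longrightarrow> (\<And>n. \<psi> n x = \<psi> n y) \<Longrightarrow> x = y"
    using compact_metrizable_separating_sequence[OF Y] by metis
  have "\<exists>N. countable N \<and> N \<subseteq> I \<and>
      (\<forall>x\<in>?C. \<forall>y\<in>?C. (\<forall>i\<in>N. x i = y i) \<longrightarrow> \<psi> n (f x) = \<psi> n (f y))" for n
    using continuous_real_depends_on_countable[OF C continuous_map_compose[OF f \<psi>(1)[of n]]]
    unfolding comp_def by metis
  then obtain N where N: "\<And>n. countable (N n)" "\<And>n. N n \<subseteq> I"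
    "\<And>n x y. x \<in> ?C \<Longrightarrow> y \<in> ?C \<Longrightarrow> \<forall>i\<in>N n. x i = y i \<Longrightarrow> \<psi> n (f x) = \<psi> n (f y)"
    by metis
  show thesis
  proof
    show "countable (\<Union>n. N n)" "(\<Union>n. N n) \<subseteq> I"
      using N(1,2) by auto
  next
    fix x y
    assume xy: "x \<in> ?C" "y \<in> ?C" and eq: "\<And>i. i \<in> (\<Union>n. N n) \<Longrightarrow> x i = y i"
    show "f x = f y"
    proof (rule \<psi>(2))
      show "f x \<in> topspace Y" "f y \<in> topspace Y"
        using f xy by (auto simp: continuous_map_def)
      show "\<psi> n (f x) = \<psi> n (f y)" for n
        using N(3)[OF xy] eq by auto
    qed
  qed
qed

section \<open>A well-founded preorder adapted to the dependence sets\<close>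

text \<open>Closing \<open>{i}\<close> under \<open>N\<close> gives a countable set
  \<open>A i\<close>. Fix a well-order of the indices and rank \<open>a\<close> by the least
  \<open>i\<close> with \<open>a \<in> A i\<close>, called \<open>\<iota> a\<close>;
  \<open>lt\<close> compares ranks. Everything of the same rank as \<open>a\<close> lies in
  \<open>A (\<iota> a)\<close>, hence countable classes. An element of \<open>N a\<close> also lies
  in \<open>A (\<iota> a)\<close>, so its rank is no larger.\<close>

lemma wf_preorder_of_countable_dependence:
  fixes N :: "'i \<Rightarrow> 'i set"
  assumes N: "\<And>i. countable (N i)"
  obtains lt :: "'i \<Rightarrow> 'i \<Rightarrow> bool"
  where "wf {(a, b). lt a b}"
    and "\<And>a b c. lt a b \<Longrightarrow> lt a c \<or> lt c b"
    and "\<And>a. countable {c. \<not> lt a c \<and> \<not> lt c a}"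
    and "\<And>a c. c \<in> N a \<Longrightarrow> \<not> lt a c"
proof -
  obtain W :: "'i rel" where W: "Well_order W" "Field W = UNIV"
    by (rule exE[OF well_ordering[where ?'a = 'i]]) blast
  define L where "L = W - Id"
  have wf: "wf L"
    using W(1) by (simp add: L_def well_order_on_def)
  have "Linear_order W"
    using W(1) by (simp add: well_order_on_def)
  then have "trans W" "antisym W" and tot: "total W"
    using W(2) by (auto simp: linear_order_on_def partial_order_on_def preorder_on_def)
  then have tr: "trans L"
    unfolding L_def by (intro trans_diff_Id)
  have total: "(a, b) \<in> L \<or> a = b \<or> (b, a) \<in> L" for a b
    using tot by (auto simp: L_def total_on_def)
  define E where "E = {(i, j). j \<in> N i}"
  define A where "A i = E\<^sup>* `` {i}" for i
  have A: "countable (A i)" for i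
  proof -
    have "countable (E `` Y)" if "countable Y" for Y
    proof -
      have "E `` Y = (\<Union>i\<in>Y. N i)"
        by (auto simp: E_def)
      then show ?thesis
        using that N by simp
    qed
    then show ?thesis
      unfolding A_def by (intro countable_rtrancl) auto
  qed
  have self: "i \<in> A i" for i
    by (simp add: A_def)
  have closed: "c \<in> A i" if "a \<in> A i" "c \<in> N a" for a c i
    using that by (auto simp: A_def E_def intro: rtrancl_into_rtrancl)
  have "\<exists>i. a \<in> A i \<and> (\<forall>j. (j, i) \<in> L \<longrightarrow> a \<notin> A j)" for a
    by (rule wfE_min[OF wf, of a "{i. a \<in> A i}"]) (use self in auto)
  then obtain \<iota> where \<iota>: "\<And>a. a \<in> A (\<iota> a)" "\<And>a j. (j, \<iota> a) \<in> L \<Longrightarrow> a \<notin> A j"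
    by metis
  show thesis
  proof
    have "{(a, b). (\<iota> a, \<iota> b) \<in> L} = inv_image L \<iota>"
      by (auto simp: inv_image_def)
    then show "wf {(a, b). (\<iota> a, \<iota> b) \<in> L}"
      using wf by simp
    show "(\<iota> a, \<iota> b) \<in> L \<Longrightarrow> (\<iota> a, \<iota> c) \<in> L \<or> (\<iota> c, \<iota> b) \<in> L" for a b c
      using total[of "\<iota> a" "\<iota> c"] tr by (auto dest: transD)
    show "countable {c. (\<iota> a, \<iota> c) \<notin> L \<and> (\<iota> c, \<iota> a) \<notin> L}" for a
    proof (rule countable_subset[OF _ A])
      show "{c. (\<iota> a, \<iota> c) \<notin> L \<and> (\<iota> c, \<iota> a) \<notin> L} \<subseteq> A (\<iota> a)"
        using total \<iota>(1) by (metis (mono_tags, lifting) mem_Collect_eq subsetI)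
    qed
    show "(\<iota> a, \<iota> c) \<notin> L" if "c \<in> N a" for a c
      using closed[OF \<iota>(1) that] \<iota>(2) by blast
  qed
qed

section \<open>An idempotent of the cube compatible with a filtration of the indices\<close>

text \<open>\<open>lt\<close> is the strict part of the linear preorder, so
  \<open>\<not> lt a c\<close> says that \<open>c\<close> is strictly below \<open>a\<close> or in
  its class. Thus \<open>r_local\<close> lets coordinate \<open>a\<close> of \<open>r x\<close>
  depend on the whole class of \<open>a\<close> as well as on what lies below it.\<close>

locale filtered_retraction =
  fixes I :: "'i set" and K :: "'i \<Rightarrow> 'a topology" and r :: "('i \<Rightarrow> 'a) \<Rightarrow> 'i \<Rightarrow> 'a"
    and z :: "'i \<Rightarrow> 'a" and \<psi> :: "'i \<Rightarrow> nat \<Rightarrow> 'a \<Rightarrow> real" and lt :: "'i \<Rightarrow> 'i \<Rightarrow> bool"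
  assumes r_cont: "continuous_map (product_topology K I) (product_topology K I) r"
    and r_idem: "\<And>x. x \<in> topspace (product_topology K I) \<Longrightarrow> r (r x) = r x"
    and z: "z \<in> topspace (product_topology K I)"
    and \<psi>_cont: "\<And>i n. i \<in> I \<Longrightarrow> continuous_map (K i) euclideanreal (\<psi> i n)"
    and \<psi>_range: "\<And>i n x. i \<in> I \<Longrightarrow> \<psi> i n x \<in> {0..1}"
    and \<psi>_sep: "\<And>i x y. \<lbrakk>i \<in> I; x \<in> topspace (K i); y \<in> topspace (K i); \<And>n. \<psi> i n x = \<psi> i n y\<rbrakk>
      \<Longrightarrow> x = y"
    and lt_wf: "wf {(a, b). lt a b}"
    and lt_cases: "\<And>a b c. lt a b \<Longrightarrow> lt a c \<or> lt c b"
    and lt_countable: "\<And>a. countable {c. \<not> lt a c \<and> \<not> lt c a}"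
    and r_local: "\<And>a x y. \<lbrakk>a \<in> I; x \<in> topspace (product_topology K I);
      y \<in> topspace (product_topology K I); \<And>c. c \<in> I \<Longrightarrow> \<not> lt a c \<Longrightarrow> x c = y c\<rbrakk> \<Longrightarrow> r x a = r y a"
begin

abbreviation C :: "('i \<Rightarrow> 'a) set"
  where "C \<equiv> topspace (product_topology K I)"

abbreviation R :: "('i \<Rightarrow> 'a) set"
  where "R \<equiv> r ` C"

text \<open>The condition \<open>\<not> lt a c\<close> instead of \<open>lt c a\<close> makes a
  downset contain, with each member, all of its class in \<open>I\<close>.\<close>

definition downset :: "'i set \<Rightarrow> bool"
  where "downset J \<longleftrightarrow> J \<subseteq> I \<and> (\<forall>a\<in>J. \<forall>c\<in>I. \<not> lt a c \<longrightarrow> c \<in> J)"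

definition below :: "'i \<Rightarrow> 'i set"
  where "below a = {c \<in> I. lt c a}"

definition upto :: "'i \<Rightarrow> 'i set"
  where "upto a = {c \<in> I. \<not> lt a c}"

text \<open>The base point outside \<open>J\<close> makes this a point of the cube even when
  \<open>x\<close> is only known to be sensible on \<open>J\<close>, as in the middle of a
  recursion.\<close>

definition fill :: "'i set \<Rightarrow> ('i \<Rightarrow> 'a) \<Rightarrow> 'i \<Rightarrow> 'a"
  where "fill J x = (\<lambda>i\<in>I. if i \<in> J then x i else z i)"

text \<open>The deviation from the prediction lies in \<open>[-1, 1]\<close> for indices in
  \<open>I\<close>. The Boolean selects its positive or negative part, so that the values fit into
  the unit interval and both vanish exactly when the deviation does.\<close>

definition coord :: "('i \<Rightarrow> 'a) \<Rightarrow> 'i \<times> nat \<times> bool \<Rightarrow> real"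
  where "coord x = (\<lambda>(a, n, s). max 0 ((if s then 1 else -1) *
    (\<psi> a n (x a) - \<psi> a n (r (fill (below a) x) a))))"

text \<open>For \<open>J = I\<close> this is membership in the Sigma-part of the cube: each index
  carries only countably many coordinates. General \<open>J\<close> serves the induction.\<close>

definition small :: "'i set \<Rightarrow> ('i \<Rightarrow> 'a) \<Rightarrow> bool"
  where "small J x \<longleftrightarrow> countable {a \<in> J. \<exists>n s. coord x (a, n, s) \<noteq> 0}"

section \<open>Locality, continuity and injectivity of the coordinates\<close>

lemma lt_irrefl: "\<not> lt a a"
  using lt_wf by (metis CollectI case_prodI wf_not_refl)

lemma lt_asym: "lt a b \<Longrightarrow> \<not> lt b a"
  using lt_wf by (metis CollectI case_prodI wf_not_sym)

lemma lt_trans: "lt a b \<Longrightarrow> lt b c \<Longrightarrow> lt a c"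
  using lt_cases lt_asym by blast

lemma lt_induct: "(\<And>a. (\<And>b. lt b a \<Longrightarrow> P b) \<Longrightarrow> P a) \<Longrightarrow> P a"
  using wf_induct[OF lt_wf, of P] by auto

lemma downset_below: "downset (below a)"
  unfolding downset_def below_def using lt_cases by blast

lemma downset_upto: "downset (upto a)"
  unfolding downset_def upto_def using lt_cases by blast

lemma C_eqI: "x \<in> C \<Longrightarrow> y \<in> C \<Longrightarrow> (\<And>i. i \<in> I \<Longrightarrow> x i = y i) \<Longrightarrow> x = y"
  by (auto intro: PiE_ext)

lemma r_in_C: "x \<in> C \<Longrightarrow> r x \<in> C"
  using r_cont by (auto simp: continuous_map_def)

lemma R_subset: "R \<subseteq> C"
  using r_in_C by auto

lemma r_fix: "x \<in> R \<Longrightarrow> r x = x"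
  using r_idem by auto

lemma r_agree:
  assumes "downset J" "x \<in> C" "y \<in> C" "\<And>i. i \<in> J \<Longrightarrow> x i = y i" "a \<in> J"
  shows "r x a = r y a"
  using assms by (intro r_local) (auto simp: downset_def)

lemma fill_in_C: "(\<And>i. i \<in> J \<Longrightarrow> i \<in> I \<Longrightarrow> x i \<in> topspace (K i)) \<Longrightarrow> fill J x \<in> C"
  using z by (auto simp: fill_def PiE_iff)

lemma fill_C: "x \<in> C \<Longrightarrow> fill J x \<in> C"
  by (rule fill_in_C) (simp add: PiE_iff)

lemma fill_apply: "i \<in> I \<Longrightarrow> i \<in> J \<Longrightarrow> fill J x i = x i"
  by (simp add: fill_def)

lemma fill_cong: "(\<And>i. i \<in> J \<Longrightarrow> x i = y i) \<Longrightarrow> fill J x = fill J y"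
  by (auto simp: fill_def)

lemma below_subset_downset: "downset J \<Longrightarrow> a \<in> J \<Longrightarrow> below a \<subseteq> J"
  unfolding downset_def below_def using lt_asym by blast

lemma coord_cong:
  assumes "downset J" "a \<in> J" "\<And>i. i \<in> J \<Longrightarrow> x i = y i"
  shows "coord x (a, n, s) = coord y (a, n, s)"
proof -
  have "fill (below a) x = fill (below a) y"
    using below_subset_downset[OF assms(1,2)] assms(3) by (intro fill_cong) auto
  then show ?thesis
    using assms(2,3) by (simp add: coord_def)
qed

lemma small_cong:
  assumes "downset J" "\<And>i. i \<in> J \<Longrightarrow> x i = y i"
  shows "small J x \<longleftrightarrow> small J y"
proof -
  have "{a \<in> J. \<exists>n s. coord x (a, n, s) \<noteq> 0} = {a \<in> J. \<exists>n s. coord y (a, n, s) \<noteq> 0}"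
    by (intro Collect_cong conj_cong refl ex_cong1 arg_cong[of _ _ "\<lambda>t. t \<noteq> 0"]
        coord_cong[OF assms(1) _ assms(2)])
  then show ?thesis
    by (simp add: small_def)
qed

lemma coord_range: "a \<in> I \<Longrightarrow> coord x (a, n, s) \<in> {0..1}"
  using \<psi>_range[of a n "x a"] \<psi>_range[of a n "r (fill (below a) x) a"] by (auto simp: coord_def)

lemma continuous_fill: "continuous_map (product_topology K I) (product_topology K I) (fill J)"
proof -
  have "continuous_map (product_topology K I) (K i) (\<lambda>x. if i \<in> J then x i else z i)" if "i \<in> I" for i
    using that z by (cases "i \<in> J") (auto intro: continuous_map_product_projection simp: PiE_iff)
  then show ?thesis
    by (subst continuous_map_componentwise) (auto simp: fill_def)
qed

lemma continuous_coord:
  assumes "a \<in> I"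
  shows "continuous_map (product_topology K I) euclideanreal (\<lambda>x. coord x (a, n, s))"
proof -
  let ?C = "product_topology K I"
  have p: "continuous_map ?C (K a) (\<lambda>x. x a)"
    using assms by (rule continuous_map_product_projection)
  have 1: "continuous_map ?C euclideanreal (\<lambda>x. \<psi> a n (x a))"
    using continuous_map_compose[OF p \<psi>_cont[OF assms]] by (simp add: comp_def)
  have "continuous_map ?C euclideanreal (\<lambda>x. \<psi> a n (r (fill (below a) x) a))"
    using continuous_map_compose[OF continuous_map_compose[OF continuous_fill r_cont] 1]
    by (simp add: comp_def)
  with 1 show ?thesis
    unfolding coord_def by (auto intro!: continuous_intros)
qed

text \<open>Induction along \<open>lt\<close>: agreement below \<open>a\<close> gives equal
  predictions at \<open>a\<close>, and the positive and negative parts of the deviation then recover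
  each \<open>\<psi> a n (x a)\<close>.\<close>

lemma coord_inj:
  assumes x: "x \<in> C" and y: "y \<in> C"
    and eq: "\<And>a n s. a \<in> I \<Longrightarrow> coord x (a, n, s) = coord y (a, n, s)"
  shows "x = y"
proof (rule C_eqI[OF x y])
  fix a
  assume "a \<in> I"
  then show "x a = y a"
  proof (induction a rule: lt_induct)
    case (1 a)
    have fill: "fill (below a) x = fill (below a) y"
      using 1 by (intro fill_cong) (auto simp: below_def)
    show ?case
    proof (rule \<psi>_sep[OF \<open>a \<in> I\<close>])
      show "x a \<in> topspace (K a)" "y a \<in> topspace (K a)"
        using x y \<open>a \<in> I\<close> by (auto simp: PiE_iff)
      show "\<psi> a n (x a) = \<psi> a n (y a)" for n
        using eq[OF \<open>a \<in> I\<close>, of n True] eq[OF \<open>a \<in> I\<close>, of n False] fill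
        by (simp add: coord_def max_def split: if_splits)
    qed
  qed
qed

text \<open>
  Beyond \<open>B\<close> every coordinate of \<open>w\<close> is read off the section \<open>u \<mapsto> r (fill (below a) u)\<close>, which is
  exactly where \<open>coord\<close> vanishes.
\<close>

lemma extend_with_zero_coords:
  assumes B: "downset B" and y: "y \<in> R"
  obtains w where "w \<in> R" and "\<And>i. i \<in> B \<Longrightarrow> w i = y i"
    and "\<And>a n s. a \<in> I - B \<Longrightarrow> coord w (a, n, s) = 0"
proof -
  have BI: "B \<subseteq> I"
    using B by (simp add: downset_def)
  have yC: "y \<in> C"
    using y R_subset by auto
  \<comment> \<open>Recursion step: copy \<open>y\<close> on \<open>B\<close>, follow the prediction
    elsewhere in \<open>I\<close>, and be \<open>undefined\<close> outside \<open>I\<close>, as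
    extensionality requires.\<close>
  define H where "H = (\<lambda>v a. if a \<in> B then y a else if a \<in> I then r (fill (below a) v) a else undefined)"
  define u where "u = wfrec {(a, b). lt a b} H"
  have u: "u a = H u a" for a
  proof -
    have "u a = H (cut u {(a, b). lt a b} a) a"
      unfolding u_def by (rule wfrec[OF lt_wf])
    also have "fill (below a) (cut u {(a, b). lt a b} a) = fill (below a) u"
      by (rule fill_cong) (simp add: below_def cut_def)
    then have "H (cut u {(a, b). lt a b} a) a = H u a"
      by (simp add: H_def)
    finally show ?thesis .
  qed
  have uB: "u a = y a" if "a \<in> B" for a
    using that by (simp add: u[of a] H_def)
  have uI: "u a = r (fill (below a) u) a" if "a \<in> I - B" for a
    using that by (subst u) (simp add: H_def)
  have "a \<in> I \<Longrightarrow> u a \<in> topspace (K a)" for a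
  proof (induction a rule: lt_induct)
    case (1 a)
    show ?case
    proof (cases "a \<in> B")
      case True
      then show ?thesis
        using yC 1(2) by (simp add: uB PiE_iff)
    next
      case False
      have "fill (below a) u \<in> C"
        using 1 by (intro fill_in_C) (auto simp: below_def)
      then show ?thesis
        using r_in_C 1(2) False by (auto simp: uI PiE_iff)
    qed
  qed
  moreover have "u x = undefined" if "x \<notin> I" for x
    using u[of x] BI that by (auto simp: H_def)
  ultimately have uC: "u \<in> C"
    by (simp add: PiE_iff extensional_def)
  \<comment> \<open>It remains to see that \<open>u\<close> is fixed by \<open>r\<close>. Outside
    \<open>B\<close>, compare \<open>u\<close> with \<open>v = r (fill (below a) u)\<close>, a point
    of \<open>R\<close>: the two agree on \<open>upto a\<close>, so locality gives
    \<open>r u a = r v a = v a = u a\<close>.\<close>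
  have "a \<in> I \<Longrightarrow> r u a = u a" for a
  proof (induction a rule: lt_induct)
    case (1 a)
    show ?case
    proof (cases "a \<in> B")
      case True
      then have "r u a = r y a"
        using r_agree[OF B uC yC uB] by blast
      then show ?thesis
        using True uB r_fix[OF y] by simp
    next
      case False
      define v where "v = r (fill (below a) u)"
      have fC: "fill (below a) u \<in> C"
        using uC by (rule fill_C)
      then have v: "v \<in> R" "v \<in> C"
        using r_in_C by (auto simp: v_def)
      have "v c = u c" if c: "c \<in> upto a" for c
      proof (cases "lt c a")
        case True
        then have cb: "c \<in> below a"
          using c by (simp add: below_def upto_def)
        have "v c = r u c"
          unfolding v_def
          by (rule r_agree[OF downset_below fC uC _ cb]) (simp add: fill_apply below_def)
        then show ?thesis
          using 1(1)[OF True] c by (simp add: upto_def)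
      next
        \<comment> \<open>Here \<open>c\<close> is in the class of \<open>a\<close>, so it is
          outside \<open>B\<close> too and has the same set below it. Hence \<open>u c\<close> is
          read off the same point \<open>v\<close>.\<close>
        case nlt: False
        have cI: "c \<in> I" "\<not> lt a c"
          using c by (auto simp: upto_def)
        have "c \<notin> B"
          using B False 1(2) nlt by (auto simp: downset_def)
        moreover have "below c = below a"
          using cI nlt lt_cases by (fastforce simp: below_def)
        ultimately show ?thesis
          using uI[of c] cI by (simp add: v_def)
      qed
      moreover have "a \<in> upto a"
        using 1(2) lt_irrefl by (simp add: upto_def)
      ultimately have "r u a = r v a" "v a = u a"
        using r_agree[OF downset_upto uC v(2), of a] by auto
      then show ?thesis
        using r_fix[OF v(1)] by simp
    qed
  qed
  then have "r u = u"
    using r_in_C[OF uC] uC by (intro C_eqI) auto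
  then have "u \<in> R"
    using uC by (metis imageI)
  moreover have "coord u (a, n, s) = 0" if "a \<in> I - B" for a n s
    using uI[OF that] by (simp add: coord_def)
  ultimately show thesis
    using that uB by blast
qed

text \<open>The restriction of \<open>R\<close> to the coordinates in \<open>J\<close> is an open map, because \<open>r\<close> maps the whole fibre
  of the cube over a point of the image of \<open>R\<close> into the corresponding fibre of \<open>R\<close>.\<close>

lemma open_restriction:
  assumes J: "downset J" and U: "openin (product_topology K I) U" and x: "x \<in> U" "x \<in> R"
  obtains V where "finite {i \<in> I. V i \<noteq> topspace (K i)}" and "\<And>i. i \<in> I \<Longrightarrow> openin (K i) (V i)"
    and "x \<in> Pi\<^sub>E I V"
    and "\<And>v. v \<in> R \<Longrightarrow> \<forall>i\<in>J. v i \<in> V i \<Longrightarrow> \<exists>x'\<in>U \<inter> R. \<forall>i\<in>J. x' i = v i"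
proof -
  have "openin (product_topology K I) {y \<in> C. r y \<in> U}"
    using r_cont U by (rule openin_continuous_map_preimage)
  moreover have xC: "x \<in> C"
    using x R_subset by auto
  then have "x \<in> {y \<in> C. r y \<in> U}"
    using x r_fix[OF x(2)] by simp
  ultimately obtain V where V: "finite {i \<in> I. V i \<noteq> topspace (K i)}"
    "\<forall>i\<in>I. openin (K i) (V i)" "x \<in> Pi\<^sub>E I V" "Pi\<^sub>E I V \<subseteq> {y \<in> C. r y \<in> U}"
    unfolding openin_product_topology_alt by meson
  show thesis
  proof (rule that[OF V(1) _ V(3)])
    show "openin (K i) (V i)" if "i \<in> I" for i
      using V(2) that by simp
    fix v
    assume v: "v \<in> R" "\<forall>i\<in>J. v i \<in> V i"
    \<comment> \<open>Gluing \<open>v\<close> on \<open>J\<close> to \<open>x\<close> elsewhere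
      stays in the box, which was chosen inside the preimage of \<open>U\<close> under
      \<open>r\<close>. So \<open>r y\<close> lies in \<open>U\<close>, and by locality it equals
      \<open>v\<close> on \<open>J\<close>.\<close>
    define y where "y i = (if i \<in> J then v i else x i)" for i
    have "y \<in> Pi\<^sub>E I V"
      using v(2) V(3) J by (auto simp: y_def PiE_iff downset_def extensional_def)
    then have y: "y \<in> C" "r y \<in> U"
      using V(4) by auto
    have "r y i = v i" if "i \<in> J" for i
      using r_agree[OF J y(1), of v i] v(1) R_subset that r_fix[OF v(1)] by (auto simp: y_def)
    then show "\<exists>x'\<in>U \<inter> R. \<forall>i\<in>J. x' i = v i"
      using y by blast
  qed
qed

section \<open>Density of the points with countable support\<close>

lemma finite_has_maximal:
  assumes "finite F" "F \<noteq> {}"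
  obtains b where "b \<in> F" and "\<And>c. c \<in> F \<Longrightarrow> \<not> lt b c"
proof -
  have "\<exists>b\<in>F. \<forall>c\<in>F. \<not> lt b c"
    using assms
  proof (induction F rule: finite_ne_induct)
    case (singleton a)
    then show ?case
      using lt_irrefl by simp
  next
    case (insert a F)
    then obtain b where b: "b \<in> F" "\<forall>c\<in>F. \<not> lt b c"
      by blast
    show ?case
    proof (cases "lt b a")
      case True
      then have "\<forall>c\<in>insert a F. \<not> lt a c"
        using b lt_irrefl lt_trans by blast
      then show ?thesis
        by blast
    next
      case False
      then show ?thesis
        using b by blast
    qed
  qed
  then show thesis
    using that by blast
qed

text \<open>By \<open>open_restriction\<close> it suffices to find a point of \<open>R\<close>,
  small on \<open>J\<close>, that meets the box conditions on \<open>J\<close>; only finitely many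
  indices \<open>F\<close> restrict it. The hypothesis below a maximal element of \<open>F\<close>
  handles these, and the extension by zero coordinates handles the rest of \<open>J\<close>.\<close>

lemma dense_small_step:
  assumes J: "downset J"
    and IH: "\<And>a U x. \<lbrakk>a \<in> J; openin (product_topology K I) U; x \<in> U; x \<in> R\<rbrakk>
      \<Longrightarrow> \<exists>y\<in>U \<inter> R. small (below a) y"
    and U: "openin (product_topology K I) U" and x: "x \<in> U" "x \<in> R"
  shows "\<exists>y\<in>U \<inter> R. small J y"
proof -
  have JI: "J \<subseteq> I"
    using J by (simp add: downset_def)
  obtain V where V: "finite {i \<in> I. V i \<noteq> topspace (K i)}" "\<And>i. i \<in> I \<Longrightarrow> openin (K i) (V i)"
    "x \<in> Pi\<^sub>E I V"
    "\<And>v. v \<in> R \<Longrightarrow> \<forall>i\<in>J. v i \<in> V i \<Longrightarrow> \<exists>x'\<in>U \<inter> R. \<forall>i\<in>J. x' i = v i"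
    by (rule open_restriction[OF J U x]) (rule that)
  define F where "F = {i \<in> J. V i \<noteq> topspace (K i)}"
  have "finite F"
    using JI by (auto simp: F_def intro: finite_subset[OF _ V(1)])
  have "\<exists>B y. downset B \<and> F \<subseteq> B \<and> y \<in> R \<and> (\<forall>i\<in>F. y i \<in> V i) \<and> small B y"
  proof (cases "F = {}")
    case True
    then show ?thesis
      using x by (intro exI[of _ "{}"] exI[of _ x]) (auto simp: downset_def small_def)
  next
    case False
    with \<open>finite F\<close> obtain b where b: "b \<in> F" "\<And>c. c \<in> F \<Longrightarrow> \<not> lt b c"
      using finite_has_maximal by blast
    have "openin (product_topology K I) (Pi\<^sub>E I V)"
      using V(1,2) by (simp add: openin_PiE_gen)
    then obtain y where y: "y \<in> Pi\<^sub>E I V" "y \<in> R" "small (below b) y"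
      using IH[of b "Pi\<^sub>E I V" x] b V(3) x by (auto simp: F_def)
    \<comment> \<open>Passing from \<open>below b\<close> to \<open>upto b\<close> adds only the
      class of \<open>b\<close>, which is countable.\<close>
    have "small (upto b) y"
      unfolding small_def
    proof (rule countable_subset)
      show "{a \<in> upto b. \<exists>n s. coord y (a, n, s) \<noteq> 0} \<subseteq>
          {a \<in> below b. \<exists>n s. coord y (a, n, s) \<noteq> 0} \<union> {c. \<not> lt b c \<and> \<not> lt c b}"
        by (auto simp: upto_def below_def)
      show "countable ({a \<in> below b. \<exists>n s. coord y (a, n, s) \<noteq> 0} \<union> {c. \<not> lt b c \<and> \<not> lt c b})"
        using y(3) lt_countable by (simp add: small_def)
    qed
    moreover have "F \<subseteq> upto b"
      using b JI by (auto simp: F_def upto_def)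
    moreover have "\<forall>i\<in>F. y i \<in> V i"
      using y(1) JI by (auto simp: F_def PiE_iff)
    ultimately show ?thesis
      using downset_upto y(2) by blast
  qed
  then obtain B y where B: "downset B" "F \<subseteq> B" and y: "y \<in> R" "\<forall>i\<in>F. y i \<in> V i" "small B y"
    by blast
  obtain w where w: "w \<in> R" "\<And>i. i \<in> B \<Longrightarrow> w i = y i"
    "\<And>a n s. a \<in> I - B \<Longrightarrow> coord w (a, n, s) = 0"
    using extend_with_zero_coords[OF B(1) y(1)] by metis
  have "small B w"
    using small_cong[OF B(1), of w y] w(2) y(3) by blast
  then have small: "small J w"
    unfolding small_def using w(3) JI by (elim countable_subset[rotated]) blast
  have "w i \<in> V i" if "i \<in> J" for i
  proof (cases "i \<in> F")
    case True
    then show ?thesis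
      using B(2) w(2) y(2) by auto
  next
    case False
    then have "V i = topspace (K i)"
      using that by (simp add: F_def)
    then show ?thesis
      using w(1) R_subset that JI by (auto simp: PiE_iff)
  qed
  \<comment> \<open>The point \<open>w\<close> need not lie in \<open>U\<close>; \<open>x'\<close>
    does, and it inherits smallness because \<open>small J\<close> only sees the coordinates in
    \<open>J\<close>.\<close>
  then obtain x' where x': "x' \<in> U \<inter> R" "\<forall>i\<in>J. x' i = w i"
    using V(4)[OF w(1)] by blast
  then show ?thesis
    using small_cong[OF J, of x' w] small by blast
qed

text \<open>Induction proves the claim for every \<open>below a\<close>. One more step covers
  \<open>I\<close>, which need not be of that form.\<close>

lemma dense_small:
  assumes "openin (product_topology K I) U" "x \<in> U" "x \<in> R"
  shows "\<exists>y\<in>U \<inter> R. small I y"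
proof -
  have "\<forall>U x. openin (product_topology K I) U \<longrightarrow> x \<in> U \<longrightarrow> x \<in> R \<longrightarrow> (\<exists>y\<in>U \<inter> R. small (below a) y)"
    for a
  proof (induction a rule: lt_induct)
    case (1 a)
    show ?case
    proof (intro allI impI)
      fix U x
      assume "openin (product_topology K I) U" "x \<in> U" "x \<in> R"
      then show "\<exists>y\<in>U \<inter> R. small (below a) y"
        using 1 by (intro dense_small_step[OF downset_below, of a U x]) (auto simp: below_def)
    qed
  qed
  moreover have "downset I"
    by (simp add: downset_def)
  ultimately show ?thesis
    using assms by (intro dense_small_step[of I U x]) blast+
qed

section \<open>The embedding into the unit cube and the conclusion\<close>

text \<open>The embedding is \<open>g\<close> followed by all coordinates \<open>coord\<close>. Its
  image is closed by compactness, which gives one inclusion; the other is \<open>dense_small\<close>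
  applied to preimages of open sets under \<open>h\<close>.\<close>

lemma valdivia_compact_range:
  fixes X :: "'b topology"
  assumes X: "compact_space X" "Hausdorff_space X"
    and g: "continuous_map X (product_topology K I) g" "inj_on g (topspace X)"
    and gR: "g ` topspace X = R"
  shows "valdivia_compact X"
proof -
  define T where "T = I \<times> (UNIV :: (nat \<times> bool) set)"
  define h where "h x = restrict (coord x) T" for x
  have hc: "continuous_map (product_topology K I) (unit_cube T) h"
  proof -
    have "continuous_map (product_topology K I) (top_of_set {0..1}) (\<lambda>x. coord x t)" if "t \<in> T" for t
      using that continuous_coord coord_range
      by (cases t) (auto simp: T_def continuous_map_in_subtopology image_subset_iff Pi_iff)
    then show ?thesis
      unfolding unit_cube_def h_def by (subst continuous_map_componentwise) auto
  qed
  have hgc: "continuous_map X (unit_cube T) (h \<circ> g)"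
    by (rule continuous_map_compose[OF g(1) hc])
  have "inj_on h C"
  proof (rule inj_onI)
    fix x y
    assume xy: "x \<in> C" "y \<in> C" and eq: "h x = h y"
    show "x = y"
    proof (rule coord_inj[OF xy])
      show "coord x (a, n, s) = coord y (a, n, s)" if "a \<in> I" for a n s
        using fun_cong[OF eq, of "(a, n, s)"] that by (simp add: h_def T_def)
    qed
  qed
  then have inj: "inj_on (h \<circ> g) (topspace X)"
    using g(2) gR R_subset by (intro comp_inj_on) (auto intro: inj_on_subset)
  have clm: "closed_map X (unit_cube T) (h \<circ> g)"
    by (rule T1_Spaces.continuous_imp_closed_map[OF hgc X(1) Hausdorff_unit_cube])
  have "(h \<circ> g) ` topspace X = unit_cube T closure_of (Sigma_cube T \<inter> (h \<circ> g) ` topspace X)"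
  proof
    show "unit_cube T closure_of (Sigma_cube T \<inter> (h \<circ> g) ` topspace X) \<subseteq> (h \<circ> g) ` topspace X"
      using clm by (intro closure_of_minimal) (auto simp: closed_map_def)
    have "h x \<in> unit_cube T closure_of (Sigma_cube T \<inter> h ` R)" if x: "x \<in> R" for x
      unfolding in_closure_of
    proof (intro conjI allI impI)
      show "h x \<in> topspace (unit_cube T)"
        using hc x R_subset by (auto simp: continuous_map_def)
      fix W
      assume W: "h x \<in> W \<and> openin (unit_cube T) W"
      have "openin (product_topology K I) {y \<in> C. h y \<in> W}"
        using hc W by (intro openin_continuous_map_preimage) auto
      then obtain y where y: "y \<in> C" "h y \<in> W" "y \<in> R" "small I y"
        using dense_small[of "{y \<in> C. h y \<in> W}" x] x W R_subset by blast
      have "{t \<in> T. h y t \<noteq> 0} \<subseteq> {a \<in> I. \<exists>n s. coord y (a, n, s) \<noteq> 0} \<times> UNIV"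
        by (auto simp: h_def T_def)
      then have "countable {t \<in> T. h y t \<noteq> 0}"
        by (rule countable_subset) (use y(4) in \<open>simp add: small_def\<close>)
      moreover have "h y \<in> topspace (unit_cube T)"
        using hc y(1) by (auto simp: continuous_map_def)
      ultimately have "h y \<in> Sigma_cube T"
        by (simp add: Sigma_cube_def)
      then show "\<exists>v. v \<in> Sigma_cube T \<inter> h ` R \<and> v \<in> W"
        using y by blast
    qed
    then show "(h \<circ> g) ` topspace X \<subseteq> unit_cube T closure_of (Sigma_cube T \<inter> (h \<circ> g) ` topspace X)"
      unfolding image_comp[symmetric] gR by blast
  qed
  moreover have "embedding_map X (unit_cube T) (h \<circ> g)"
    by (rule injective_closed_imp_embedding_map[OF hgc clm inj])
  ultimately have "valdivia_embedding X T (h \<circ> g)"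
    by (simp add: valdivia_embedding_def)
  with X show ?thesis
    by (rule valdivia_compactI)
qed

end

text \<open>Treated apart because the base point \<open>z\<close> of the general argument is taken
  from the image of \<open>X\<close> in the cube.\<close>

lemma valdivia_compact_empty: "topspace X = {} \<Longrightarrow> valdivia_compact X"
proof -
  assume "topspace X = {}"
  then have X: "X = trivial_topology"
    by simp
  have "valdivia_embedding X ({} :: unit set) (\<lambda>_. undefined)"
    by (simp add: valdivia_embedding_def X injective_closed_imp_embedding_map closed_map_def)
  then show ?thesis
    by (intro valdivia_compactI) (auto simp: X)
qed

theorem corollary4p5:
  fixes I :: "'i set" and K :: "'i \<Rightarrow> 'a topology" and X :: "'b topology"
    and f :: "('i \<Rightarrow> 'a) \<Rightarrow> 'b"
  assumes "\<And>i. i \<in> I \<Longrightarrow> metrizable_space (K i)"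
    and "\<And>i. i \<in> I \<Longrightarrow> compact_space (K i)"
    and "Hausdorff_space X"
    and "retraction_map (product_topology K I) X f"
  shows "valdivia_compact X"
proof (cases "topspace X = {}")
  case True
  then show ?thesis
    by (rule valdivia_compact_empty)
next
  case False
  let ?C = "product_topology K I"
  obtain g where f: "continuous_map ?C X f" and g: "continuous_map X ?C g"
    and fg: "\<And>x. x \<in> topspace X \<Longrightarrow> f (g x) = x"
    using assms(4) by (auto simp: retraction_map_def retraction_maps_def)
  have fX: "f x \<in> topspace X" if "x \<in> topspace ?C" for x
    using f that by (auto simp: continuous_map_def)
  have gC: "g x \<in> topspace ?C" if "x \<in> topspace X" for x
    using g that unfolding continuous_map_def by blast
  obtain z where z: "z \<in> topspace ?C"
    using False gC by blast
  have C: "compact_space ?C"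
    using assms(2) by (simp add: compact_space_product_topology)
  have r: "continuous_map ?C ?C (g \<circ> f)"
    using f g by (rule continuous_map_compose)
  have X: "compact_space X"
    using image_compactin[OF C[unfolded compact_space_def] f]
      retraction_imp_surjective_map[OF assms(4)] by (simp add: compact_space_def)
  have "\<exists>\<psi> :: nat \<Rightarrow> 'a \<Rightarrow> real. (\<forall>n. continuous_map (K i) euclideanreal (\<psi> n)) \<and>
      (\<forall>n x. \<psi> n x \<in> {0..1}) \<and>
      (\<forall>x\<in>topspace (K i). \<forall>y\<in>topspace (K i). (\<forall>n. \<psi> n x = \<psi> n y) \<longrightarrow> x = y)" if "i \<in> I" for i
    using compact_metrizable_separating_sequence[OF assms(1,2)[OF that]] by metis
  then obtain \<psi> :: "'i \<Rightarrow> nat \<Rightarrow> 'a \<Rightarrow> real" where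
    \<psi>: "\<And>i n. i \<in> I \<Longrightarrow> continuous_map (K i) euclideanreal (\<psi> i n)"
      "\<And>i n x. i \<in> I \<Longrightarrow> \<psi> i n x \<in> {0..1}"
      "\<And>i x y. \<lbrakk>i \<in> I; x \<in> topspace (K i); y \<in> topspace (K i); \<forall>n. \<psi> i n x = \<psi> i n y\<rbrakk> \<Longrightarrow> x = y"
    by metis
  \<comment> \<open>Indices outside \<open>I\<close> receive a countable set as well, since the
    preorder is built on the whole index type.\<close>
  have "\<exists>N. countable N \<and> N \<subseteq> I \<and> (i \<in> I \<longrightarrow> (\<forall>x\<in>topspace ?C. \<forall>y\<in>topspace ?C.
      (\<forall>j\<in>N. x j = y j) \<longrightarrow> g (f x) i = g (f y) i))" for i
  proof (cases "i \<in> I")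
    case True
    have "continuous_map ?C (K i) (\<lambda>x. g (f x) i)"
      using continuous_map_compose[OF r continuous_map_product_projection[OF True]]
      by (simp add: comp_def)
    then show ?thesis
      using continuous_metrizable_depends_on_countable[OF C assms(1,2)[OF True]] by metis
  qed auto
  then obtain N where N: "\<And>i. countable (N i)" "\<And>i. N i \<subseteq> I"
    "\<And>i x y. \<lbrakk>i \<in> I; x \<in> topspace ?C; y \<in> topspace ?C; \<forall>j\<in>N i. x j = y j\<rbrakk>
      \<Longrightarrow> g (f x) i = g (f y) i"
    by metis
  obtain lt :: "'i \<Rightarrow> 'i \<Rightarrow> bool" where lt: "wf {(a, b). lt a b}"
    "\<And>a b c. lt a b \<Longrightarrow> lt a c \<or> lt c b" "\<And>a. countable {c. \<not> lt a c \<and> \<not> lt c a}"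
    "\<And>a c. c \<in> N a \<Longrightarrow> \<not> lt a c"
    by (rule wf_preorder_of_countable_dependence[of N]) (rule N(1), rule that)
  interpret filtered_retraction I K "g \<circ> f" z \<psi> lt
  proof (unfold_locales; (fact r z lt(1) lt(3))?)
    show "(g \<circ> f) ((g \<circ> f) x) = (g \<circ> f) x" if "x \<in> topspace ?C" for x
      using fX[OF that] fg by simp
    show "continuous_map (K i) euclideanreal (\<psi> i n)" if "i \<in> I" for i n
      using \<psi>(1) that .
    show "\<psi> i n x \<in> {0..1}" if "i \<in> I" for i n x
      using \<psi>(2) that .
    show "x = y" if "i \<in> I" "x \<in> topspace (K i)" "y \<in> topspace (K i)" "\<And>n. \<psi> i n x = \<psi> i n y"
      for i x y
      using \<psi>(3) that by blast
    show "lt a c \<or> lt c b" if "lt a b" for a b c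
      using lt(2) that .
    \<comment> \<open>No element of \<open>N a\<close> is strictly above \<open>a\<close>, so the
      assumed agreement covers all of \<open>N a\<close>.\<close>
    show "(g \<circ> f) x a = (g \<circ> f) y a" if "a \<in> I" "x \<in> topspace ?C" "y \<in> topspace ?C"
      "\<And>c. c \<in> I \<Longrightarrow> \<not> lt a c \<Longrightarrow> x c = y c" for a x y
      using N(3)[OF that(1-3)] that(4) lt(4) N(2) by (metis comp_apply subsetD)
  qed
  show ?thesis
  proof (rule valdivia_compact_range[OF X assms(3) g])
    show "inj_on g (topspace X)"
      using fg by (metis inj_onI)
    show "g ` topspace X = (g \<circ> f) ` topspace ?C"
    proof
      show "(g \<circ> f) ` topspace ?C \<subseteq> g ` topspace X"
        using fX by auto
      show "g ` topspace X \<subseteq> (g \<circ> f) ` topspace ?C"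
        using fg gC by (force simp: image_iff)
    qed
  qed
qed

end
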